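(* Let $n\ge 3$, let $\Omega\subset\mathbb{R}^n$ be a bounded domain with smooth boundary, and let $u_\lambda$ be a real-valued, not identically zero Dirichlet eigenfunction of the Laplacian on $\Omega$ with eigenvalue $\lambda$, i.e. $-\sum_{j=1}^n \partial_{x_j}^2 u_\lambda=\lambda u_\lambda$ in $\Omega$ and $u_\lambda=0$ on $\partial\Omega$. Let $A_i$ be any nodal domain of $u_\lambda$ and, for $\delta\in(0,1)$, put $$V^i_\delta=\{x\in A_i : |u_\lambda(x)|\ge \delta\,\|u_\lambda\|_{L^\infty(A_i)}\}.$$ Then for all $\delta\in(0,1)$, $$\operatorname{Vol}(V^i_\delta)\ \ge\ (1-\delta)^{\frac n2}\,(2(n-2))^{\frac n2}\,\alpha_n\,\lambda^{-\frac n2},$$ where $\alpha_n$ is the volume of the $n$-dimensional unit ball.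
   Context: A nodal domain of $u_\lambda$ is a maximal connected open subset of $\{u_\lambda\neq 0\}$. $\operatorname{Vol}$ is Lebesgue measure. *)

theory Defs
  imports "HOL-Analysis.Analysis" "HOL-Probability.Essential_Supremum"
begin

definition partial :: "'n::finite \<Rightarrow> (real^'n \<Rightarrow> real) \<Rightarrow> real^'n \<Rightarrow> real" where
  "partial j f x = deriv (\<lambda>t. f (x + t *\<^sub>R axis j 1)) 0"

definition laplacian :: "(real^'n::finite \<Rightarrow> real) \<Rightarrow> real^'n \<Rightarrow> real" where
  "laplacian f x = (\<Sum>j\<in>UNIV. partial j (partial j f) x)"

text \<open>The class \<open>C\<^sup>k\<close>, intended for open sets \<open>S\<close>.\<close>

primrec Ck_on :: "nat \<Rightarrow> (real^'n::finite) set \<Rightarrow> (real^'n \<Rightarrow> real) \<Rightarrow> bool" where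
  "Ck_on 0 S f \<longleftrightarrow> continuous_on S f"
| "Ck_on (Suc k) S f \<longleftrightarrow> f differentiable_on S \<and> (\<forall>j. Ck_on k S (partial j f))"

definition smooth_on :: "(real^'n::finite) set \<Rightarrow> (real^'n \<Rightarrow> real) \<Rightarrow> bool" where
  "smooth_on S f \<longleftrightarrow> (\<forall>k. Ck_on k S f)"

text \<open>Near each boundary point, \<open>\<Omega>\<close> is the part of a ball lying strictly on one side of the
  graph of a smooth function of the coordinates other than the \<open>i\<close>-th. Such a function is encoded
  as a function \<open>\<gamma>\<close> on the whole space that does not depend on the \<open>i\<close>-th coordinate; the sign
  \<open>s\<close> selects the side.\<close>

definition smooth_boundary :: "(real^'n::finite) set \<Rightarrow> bool" where
  "smooth_boundary \<Omega> \<longleftrightarrow>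
     (\<forall>p\<in>frontier \<Omega>. \<exists>r>0. \<exists>i. \<exists>s\<in>{1, -1}. \<exists>\<gamma>.
        smooth_on UNIV \<gamma> \<and>
        (\<forall>x y. (\<forall>j. j \<noteq> i \<longrightarrow> x $ j = y $ j) \<longrightarrow> \<gamma> x = \<gamma> y) \<and>
        \<Omega> \<inter> ball p r = {x \<in> ball p r. s * x $ i > \<gamma> x})"

definition bounded_smooth_domain :: "(real^'n::finite) set \<Rightarrow> bool" where
  "bounded_smooth_domain \<Omega> \<longleftrightarrow>
     \<Omega> \<noteq> {} \<and> open \<Omega> \<and> connected \<Omega> \<and> bounded \<Omega> \<and> smooth_boundary \<Omega>"

text \<open>Classical real-valued eigenfunctions. Only the values on the closure of \<open>\<Omega>\<close> matter.\<close>

definition dirichlet_eigenfunction ::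
    "(real^'n::finite) set \<Rightarrow> real \<Rightarrow> (real^'n \<Rightarrow> real) \<Rightarrow> bool" where
  "dirichlet_eigenfunction \<Omega> lam u \<longleftrightarrow>
     Ck_on 2 \<Omega> u \<and> continuous_on (closure \<Omega>) u \<and>
     (\<exists>x\<in>\<Omega>. u x \<noteq> 0) \<and>
     (\<forall>x\<in>\<Omega>. - laplacian u x = lam * u x) \<and>
     (\<forall>x\<in>frontier \<Omega>. u x = 0)"

definition nodal_domain :: "(real^'n::finite) set \<Rightarrow> (real^'n \<Rightarrow> real) \<Rightarrow> (real^'n) set \<Rightarrow> bool" where
  "nodal_domain \<Omega> u A \<longleftrightarrow>
     open A \<and> connected A \<and> A \<subseteq> {x\<in>\<Omega>. u x \<noteq> 0} \<and>
     (\<forall>B. open B \<and> connected B \<and> B \<subseteq> {x\<in>\<Omega>. u x \<noteq> 0} \<and> A \<subseteq> B \<longrightarrow> B = A)"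

definition Linf_norm :: "(real^'n::finite) set \<Rightarrow> (real^'n \<Rightarrow> real) \<Rightarrow> ennreal" where
  "Linf_norm A f = esssup (lebesgue_on A) (\<lambda>x. ennreal \<bar>f x\<bar>)"

definition high_set :: "(real^'n::finite) set \<Rightarrow> (real^'n \<Rightarrow> real) \<Rightarrow> real \<Rightarrow> (real^'n) set" where
  "high_set A u \<delta> = {x\<in>A. ennreal \<bar>u x\<bar> \<ge> ennreal \<delta> * Linf_norm A u}"

end

theory Submission
  imports Defs
begin

text \<open>
  The sign of \<open>u\<close> is constant on the nodal domain \<open>A\<close>, so \<open>v = \<bar>u\<bar>\<close> is a positive function on
  \<open>A\<close> that vanishes on the frontier of \<open>A\<close>, satisfies \<open>-\<Delta> v = \<lambda> v\<close> and attains its maximum \<open>M\<close> at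
  some \<open>x\<^sub>0 \<in> A\<close>. There \<open>\<Delta> v \<le> 0\<close>, so \<open>\<lambda> \<ge> 0\<close>, and for \<open>\<lambda> = 0\<close> the right-hand side is \<open>0 powr _ = 0\<close>. Let \<open>V\<close> be the set where \<open>v \<ge> \<delta> M\<close>, let \<open>\<alpha>\<close> be the volume of the unit ball and
  let \<open>\<Phi> x\<close> be the integral of \<open>\<bar>x - y\<bar>\<^sup>2\<^sup>-\<^sup>n\<close> over \<open>y \<in> V\<close>, so that \<open>-\<Delta> \<Phi> = n (n - 2) \<alpha>\<close> in the
  interior of \<open>V\<close>. On \<open>V\<close> the function \<open>v - \<delta> M\<close> has \<open>-\<Delta>\<close> at most \<open>\<lambda> M\<close> and vanishes on the boundary,
  while \<open>\<Phi> \<ge> 0\<close>. The maximum principle therefore gives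
  \<open>v - \<delta> M \<le> \<lambda> M \<Phi> / (n (n - 2) \<alpha>)\<close> on \<open>V\<close>. At \<open>x\<^sub>0\<close> the left side is \<open>(1 - \<delta>) M\<close>. Among all sets
  of a given volume \<open>\<alpha> R\<^sup>n\<close> the integral \<open>\<Phi> x\<^sub>0\<close> is largest for the ball of radius \<open>R\<close> around \<open>x\<^sub>0\<close>,
  where it equals \<open>n \<alpha> R\<^sup>2 / 2\<close>. Hence \<open>1 - \<delta> \<le> \<lambda> R\<^sup>2 / (2 (n - 2))\<close>, which is the claimed lower
  bound for the volume of \<open>V\<close>.

  Two devices avoid the regularity theory of potentials. The kernel \<open>\<bar>z\<bar>\<^sup>2\<^sup>-\<^sup>n\<close> is replaced for
  \<open>\<bar>z\<bar> < \<epsilon>\<close> by the paraboloid that continues it differentiably; this is, up to a constant factor, the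
  potential of the uniform mass on a ball of radius \<open>\<epsilon>\<close>, so the Laplacian of the resulting
  \<open>\<Phi>\<close> at \<open>x\<close> is exactly \<open>-n (n - 2) \<alpha>\<close> as soon as the \<open>\<epsilon>\<close>-ball around \<open>x\<close> lies in \<open>V\<close>
  (\<open>discrete_laplacian_potential_tendsto\<close>). And Laplacians are taken as limits of second difference
  quotients, which commute with the integral and suffice for the maximum principle
  (\<open>potential_comparison\<close>). The comparison is made on the set where \<open>v \<ge> \<delta>' M\<close> for some
  \<open>\<delta>' > \<delta>\<close>; it is compact in the interior of \<open>V\<close>, which provides a uniform \<open>\<epsilon>\<close>, and \<open>\<delta>'\<close> then tends
  to \<open>\<delta>\<close>. The bound for \<open>\<Phi> x\<^sub>0\<close> is \<open>nn_integral_newtonian_le\<close>.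
\<close>

section \<open>Second difference quotients\<close>

definition diff2 :: "'a::real_vector \<Rightarrow> ('a \<Rightarrow> real) \<Rightarrow> 'a \<Rightarrow> real" where
  "diff2 v f x = f (x + v) + f (x - v) - 2 * f x"

definition discrete_laplacian :: "real \<Rightarrow> (real^'n::finite \<Rightarrow> real) \<Rightarrow> real^'n \<Rightarrow> real" where
  "discrete_laplacian h f x = (\<Sum>j\<in>UNIV. diff2 (h *\<^sub>R axis j 1) f x / h\<^sup>2)"

text \<open>L'Hopital's rule reduces the claim to \<open>(g' h - g' (-h)) / (2 h) \<rightarrow> D\<close>, so that \<open>g'\<close> only has to be
  differentiable at the single point \<open>0\<close>. This is all that
  twice differentiability at a point provides.\<close>

lemma diff2_quotient_tendsto:
  fixes g g' :: "real \<Rightarrow> real"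
  assumes g: "\<forall>\<^sub>F t in nhds 0. (g has_real_derivative g' t) (at t)"
    and g': "(g' has_real_derivative D) (at 0)"
  shows "((\<lambda>h. diff2 h g 0 / h\<^sup>2) \<longlongrightarrow> D) (at 0)"
proof -
  have neg: "filterlim uminus (at 0) (at (0::real))"
    by (auto simp: filterlim_at eventually_at_filter intro!: tendsto_eq_intros)
  have gpos: "\<forall>\<^sub>F h in at 0. (g has_real_derivative g' h) (at h)"
    using g by (simp add: eventually_at_filter eventually_mono)
  have gneg: "\<forall>\<^sub>F h in at 0. (g has_real_derivative g' (-h)) (at (-h))"
    by (rule eventually_compose_filterlim[OF gpos neg])
  have g0: "(g has_real_derivative g' 0) (at 0)"
    using g by (rule eventually_nhds_x_imp_x)
  then have cont: "(g \<longlongrightarrow> g 0) (at 0)"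
    using DERIV_isCont isCont_def by blast
  have lim: "((\<lambda>h. (g h + g (-h) - 2 * g 0) / h\<^sup>2) \<longlongrightarrow> D) (at 0)"
  proof (rule lhopital)
    show "((\<lambda>h. g h + g (-h) - 2 * g 0) \<longlongrightarrow> 0) (at 0)"
      using cont filterlim_compose[OF cont neg] by (auto intro!: tendsto_eq_intros)
    show "((\<lambda>h. h\<^sup>2) \<longlongrightarrow> (0::real)) (at 0)"
      by (auto intro!: tendsto_eq_intros)
    show "\<forall>\<^sub>F h in at 0. h\<^sup>2 \<noteq> (0::real)" "\<forall>\<^sub>F h in at 0. 2 * h \<noteq> (0::real)"
      by (auto simp: eventually_at_filter)
    show "\<forall>\<^sub>F h in at 0. ((\<lambda>h. h\<^sup>2) has_real_derivative 2 * h) (at h)"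
      by (auto intro!: always_eventually derivative_eq_intros)
    show "\<forall>\<^sub>F h in at 0. ((\<lambda>h. g h + g (-h) - 2 * g 0) has_real_derivative g' h - g' (-h)) (at h)"
      using gpos gneg
    proof eventually_elim
      case (elim h)
      have "((\<lambda>h. g (-h)) has_real_derivative g' (-h) * (-1)) (at h)"
        using elim(2) by (subst (asm) DERIV_mirror) (simp add: o_def)
      with elim(1) show ?case
        by (auto intro!: derivative_eq_intros)
    qed
    have q: "((\<lambda>h. (g' h - g' 0) / h) \<longlongrightarrow> D) (at 0)"
      using g' by (simp add: has_field_derivative_iff)
    have "((\<lambda>h. ((g' h - g' 0) / h + (g' (-h) - g' 0) / (-h)) / 2) \<longlongrightarrow> (D + D) / 2) (at 0)"
      by (intro tendsto_intros q filterlim_compose[OF q neg]) auto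
    moreover have "\<forall>\<^sub>F h in at 0. ((g' h - g' 0) / h + (g' (-h) - g' 0) / (-h)) / 2 = (g' h - g' (-h)) / (2 * h)"
      by (auto simp: eventually_at_filter divide_simps intro!: always_eventually)
    ultimately have "((\<lambda>h. (g' h - g' (-h)) / (2 * h)) \<longlongrightarrow> (D + D) / 2) (at 0)"
      by (rule tendsto_cong[THEN iffD1, rotated])
    then show "((\<lambda>h. (g' h - g' (-h)) / (2 * h)) \<longlongrightarrow> D) (at 0)"
      by simp
  qed
  then show ?thesis
    by (simp add: diff2_def)
qed

lemma partial_has_derivative_line:
  fixes f :: "real^'n::finite \<Rightarrow> real"
  assumes "f differentiable (at x)"
  shows "((\<lambda>t. f (x + t *\<^sub>R axis j 1)) has_real_derivative partial j f x) (at 0)"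
proof -
  have "(\<lambda>t. f (x + t *\<^sub>R axis j 1)) differentiable (at 0)"
    by (rule differentiable_compose[of f]) (use assms in auto)
  then show ?thesis
    unfolding partial_def by (metis DERIV_imp_deriv real_differentiable_def)
qed

lemma discrete_laplacian_tendsto:
  fixes u :: "real^'n::finite \<Rightarrow> real"
  assumes "open S" "x \<in> S" and u: "Ck_on 2 S u"
  shows "((\<lambda>h. discrete_laplacian h u x) \<longlongrightarrow> laplacian u x) (at 0)"
  unfolding discrete_laplacian_def laplacian_def
proof (rule tendsto_sum)
  fix j :: 'n
  define e :: "real^'n" where "e = axis j 1"
  have d1: "u differentiable (at y)" and d2: "partial j u differentiable (at y)" if "y \<in> S" for y
    using u that \<open>open S\<close> 
    by (auto simp: numeral_2_eq_2 differentiable_on_eq_differentiable_at)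
  have shift: "((\<lambda>t. u (x + t *\<^sub>R e)) has_real_derivative partial j u (x + t *\<^sub>R e)) (at t)"
    if "x + t *\<^sub>R e \<in> S" for t
    using partial_has_derivative_line[OF d1[OF that], of j]
      DERIV_shift[of "\<lambda>t. u (x + t *\<^sub>R e)" _ 0 t]
    by (simp add: e_def algebra_simps)
  have "open ((\<lambda>t::real. x + t *\<^sub>R e) -` S)"
    by (intro open_vimage \<open>open S\<close> continuous_intros)
  then have "\<forall>\<^sub>F t in nhds 0. t \<in> (\<lambda>t::real. x + t *\<^sub>R e) -` S"
    by (rule eventually_nhds_in_open) (use \<open>x \<in> S\<close> in simp)
  then have "\<forall>\<^sub>F t in nhds 0. ((\<lambda>t. u (x + t *\<^sub>R e)) has_real_derivative partial j u (x + t *\<^sub>R e)) (at t)"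
    by eventually_elim (use shift in auto)
  from diff2_quotient_tendsto[OF this partial_has_derivative_line[OF d2[OF \<open>x \<in> S\<close>], of j, folded e_def]]
  show "((\<lambda>h. diff2 (h *\<^sub>R axis j 1) u x / h\<^sup>2) \<longlongrightarrow> partial j (partial j u) x) (at 0)"
    by (simp add: diff2_def e_def)
qed

section \<open>The truncated Newtonian kernel\<close>

text \<open>The convex function \<open>s\<^sup>1\<^sup>-\<^sup>p\<close>, continued below \<open>s = a\<close> by its tangent line at \<open>a\<close>. With
  \<open>p = n / 2\<close>, \<open>a = \<epsilon>\<^sup>2\<close> and \<open>s = \<bar>z\<bar>\<^sup>2\<close> it becomes the truncated Newtonian kernel.\<close>

definition truncated_power :: "real \<Rightarrow> real \<Rightarrow> real \<Rightarrow> real" where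
  "truncated_power p a s = (if s \<le> a then a powr (1 - p) - (p - 1) * a powr (-p) * (s - a) else s powr (1 - p))"

definition truncated_power_deriv :: "real \<Rightarrow> real \<Rightarrow> real \<Rightarrow> real" where
  "truncated_power_deriv p a s = (1 - p) * max s a powr (-p)"

lemma truncated_power_has_derivative:
  assumes "0 < a"
  shows "(truncated_power p a has_real_derivative truncated_power_deriv p a s) (at s)"
proof -
  have "(truncated_power p a has_vector_derivative 
      (if s \<in> {..a} then (1 - p) * a powr (-p) else (1 - p) * s powr (-p))) (at s within {..a} \<union> {a<..})"
    unfolding truncated_power_def atMost_iff[symmetric]
  proof (rule has_vector_derivative_If_within_closures)
    show "((\<lambda>s. a powr (1 - p) - (p - 1) * a powr (-p) * (s - a)) has_vector_derivative
      (1 - p) * a powr (-p)) (at s within {..a} \<union> closure {..a} \<inter> closure {a<..})"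
      unfolding has_real_derivative_iff_has_vector_derivative[symmetric]
      by (auto intro!: derivative_eq_intros simp: algebra_simps)
    show "((\<lambda>s. s powr (1 - p)) has_vector_derivative (1 - p) * s powr (-p))
      (at s within {a<..} \<union> closure {..a} \<inter> closure {a<..})" 
      if "s \<in> {a<..} \<union> closure {..a} \<inter> closure {a<..}"
      unfolding has_real_derivative_iff_has_vector_derivative[symmetric]
      using that assms by (auto intro!: derivative_eq_intros simp: algebra_simps split: if_splits)
  qed auto
  moreover have "{..a} \<union> {a<..} = UNIV"
    by auto
  ultimately show ?thesis
    by (auto simp: has_real_derivative_iff_has_vector_derivative truncated_power_deriv_def max_def split: if_splits)
qed

lemma truncated_power_deriv_bounds:
  assumes "0 < a" "1 \<le> p"
  shows "\<bar>truncated_power_deriv p a s\<bar> \<le> (p - 1) * a powr (-p)"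
proof -
  have "max s a powr (-p) \<le> a powr (-p)"
    using assms by (intro powr_mono2') auto
  with assms show ?thesis
    by (simp add: truncated_power_deriv_def abs_mult mult_left_mono)
qed

lemma truncated_power_deriv_lipschitz:
  assumes "0 < a" "1 \<le> p"
  shows "\<bar>truncated_power_deriv p a s - truncated_power_deriv p a t\<bar> \<le> (p - 1) * (p * a powr (-p-1)) * \<bar>s - t\<bar>"
proof -
  have le: "\<bar>y powr (-p) - x powr (-p)\<bar> \<le> p * a powr (-p-1) * (y - x)" if "a \<le> x" "x \<le> y" for x y
  proof (cases "x = y")
    case False
    then have "x < y"
      using that by simp
    obtain z where z: "x < z" "z < y" "y powr (-p) - x powr (-p) = (y - x) * (-p * z powr (-p-1))"
    proof -
      have "((\<lambda>z. z powr (-p)) has_real_derivative -p * z powr (-p-1)) (at z)" if "x \<le> z" for z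
        using that \<open>a \<le> x\<close> assms by (auto intro!: derivative_eq_intros)
      then show thesis
        using MVT2[OF \<open>x < y\<close>, of "\<lambda>z. z powr (-p)" "\<lambda>z. -p * z powr (-p-1)"] that by blast
    qed
    have "z powr (-p-1) \<le> a powr (-p-1)"
      using assms that z by (intro powr_mono2') auto
    then have "(y - x) * (p * z powr (-p-1)) \<le> (y - x) * (p * a powr (-p-1))"
      using assms \<open>x < y\<close> by (intro mult_left_mono) auto
    moreover have "\<bar>y powr (-p) - x powr (-p)\<bar> = (y - x) * (p * z powr (-p-1))"
      using z assms \<open>x < y\<close> by (simp add: abs_mult)
    ultimately show ?thesis
      by (simp add: mult_ac)
  qed simp
  have le': "\<bar>y powr (-p) - x powr (-p)\<bar> \<le> p * a powr (-p-1) * \<bar>y - x\<bar>" if "a \<le> x" "a \<le> y" for x y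
    using le[of x y] le[of y x] that by (cases "x \<le> y") (auto simp: abs_minus_commute)
  have "\<bar>truncated_power_deriv p a s - truncated_power_deriv p a t\<bar> = \<bar>1 - p\<bar> * \<bar>max s a powr (-p) - max t a powr (-p)\<bar>"
    by (simp add: truncated_power_deriv_def flip: abs_mult right_diff_distrib)
  also have "\<dots> \<le> \<bar>1 - p\<bar> * (p * a powr (-p-1) * \<bar>max s a - max t a\<bar>)"
    using assms by (intro mult_left_mono le') auto
  also have "\<dots> \<le> (p - 1) * (p * a powr (-p-1) * \<bar>s - t\<bar>)"
    using assms by (intro mult_mono) auto
  finally show ?thesis
    by (simp add: mult_ac)
qed

text \<open>A second-order Taylor bound holds across the junction \<open>s = a\<close>, although the second derivative
  jumps there, because the derivative is Lipschitz.\<close>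

lemma truncated_power_taylor:
  assumes "0 < a" "1 \<le> p"
  shows "\<bar>truncated_power p a t - truncated_power p a s - truncated_power_deriv p a s * (t - s)\<bar> \<le> (p - 1) * (p * a powr (-p-1)) * (t - s)\<^sup>2"
proof -
  define C where "C = (p - 1) * (p * a powr (-p-1))"
  have "C \<ge> 0"
    using assms by (simp add: C_def)
  have "\<exists>z. \<bar>z - s\<bar> \<le> \<bar>t - s\<bar> \<and> truncated_power p a t - truncated_power p a s = (t - s) * truncated_power_deriv p a z"
  proof (cases s t rule: linorder_cases)
    case less
    show ?thesis
      using MVT2[OF less, of "truncated_power p a" "truncated_power_deriv p a"] truncated_power_has_derivative[OF \<open>0 < a\<close>] by force
  next
    case greater
    obtain z where "t < z" "z < s" "truncated_power p a s - truncated_power p a t = (s - t) * truncated_power_deriv p a z"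
      using MVT2[OF greater, of "truncated_power p a" "truncated_power_deriv p a"] truncated_power_has_derivative[OF \<open>0 < a\<close>] by blast
    then show ?thesis
      by (intro exI[of _ z]) (auto simp: algebra_simps)
  qed auto
  then obtain z where z: "\<bar>z - s\<bar> \<le> \<bar>t - s\<bar>" "truncated_power p a t - truncated_power p a s = (t - s) * truncated_power_deriv p a z"
    by blast
  have "\<bar>truncated_power p a t - truncated_power p a s - truncated_power_deriv p a s * (t - s)\<bar> = \<bar>t - s\<bar> * \<bar>truncated_power_deriv p a z - truncated_power_deriv p a s\<bar>"
    by (simp add: z(2) algebra_simps flip: abs_mult)
  also have "\<dots> \<le> \<bar>t - s\<bar> * (C * \<bar>z - s\<bar>)"
    unfolding C_def by (intro mult_left_mono truncated_power_deriv_lipschitz assms) auto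
  also have "\<dots> \<le> \<bar>t - s\<bar> * (C * \<bar>t - s\<bar>)"
    using z(1) \<open>C \<ge> 0\<close> by (intro mult_left_mono) auto
  also have "\<dots> = C * (t - s)\<^sup>2"
    by (simp add: power2_eq_square mult_ac)
  finally show ?thesis
    by (simp add: C_def)
qed

lemma truncated_power_nonneg:
  assumes "0 < a" "1 \<le> p"
  shows "0 \<le> truncated_power p a s"
  using assms by (auto simp: truncated_power_def mult_nonneg_nonpos intro!: order_trans[OF mult_nonneg_nonpos])

lemma truncated_power_antimono:
  assumes "0 < a" "1 \<le> p" "s \<le> t"
  shows "truncated_power p a t \<le> truncated_power p a s"
proof (rule DERIV_nonpos_imp_nonincreasing[OF \<open>s \<le> t\<close>])
  show "\<exists>y. (truncated_power p a has_real_derivative y) (at x) \<and> y \<le> 0" for x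
    using assms by (intro exI[of _ "truncated_power_deriv p a x"] conjI truncated_power_has_derivative)
      (auto simp: truncated_power_deriv_def mult_nonpos_nonneg)
qed

text \<open>A convex function lies above its tangent lines.\<close>

lemma truncated_power_le_powr:
  assumes "0 < a" "1 \<le> p" "0 < s"
  shows "truncated_power p a s \<le> s powr (1 - p)"
proof (cases "s < a")
  case True
  define f where "f = (\<lambda>s. s powr (1 - p) - truncated_power p a s)"
  have "f a \<le> f s"
  proof (rule DERIV_nonpos_imp_nonincreasing[of s a f])
    fix x assume x: "s \<le> x" "x \<le> a"
    have "(f has_real_derivative (1 - p) * x powr (-p) - truncated_power_deriv p a x) (at x)"
      unfolding f_def using x assms
      by (auto intro!: derivative_eq_intros truncated_power_has_derivative simp: algebra_simps)
    moreover have "(1 - p) * x powr (-p) - truncated_power_deriv p a x = - ((p - 1) * (x powr (-p) - a powr (-p)))"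
      using x by (simp add: truncated_power_deriv_def max_def algebra_simps)
    moreover have "a powr (-p) \<le> x powr (-p)"
      using x assms by (intro powr_mono2') auto
    then have "0 \<le> (p - 1) * (x powr (-p) - a powr (-p))"
      using assms by simp
    ultimately show "\<exists>y. (f has_real_derivative y) (at x) \<and> y \<le> 0"
      by auto
  qed (use True in auto)
  then show ?thesis
    by (simp add: f_def truncated_power_def)
qed (use assms in \<open>auto simp: truncated_power_def\<close>)

definition newton_kernel :: "real \<Rightarrow> real^'n::finite \<Rightarrow> real" where
  "newton_kernel \<epsilon> z = truncated_power (real CARD('n) / 2) (\<epsilon>\<^sup>2) ((norm z)\<^sup>2)"

lemma norm_line: 
  fixes z :: "real^'n::finite"
  shows "(norm (z + t *\<^sub>R axis j 1))\<^sup>2 = (norm z)\<^sup>2 + 2 * t * z $ j + t\<^sup>2"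
  unfolding power2_norm_eq_inner
  by (simp add: inner_add_left inner_add_right inner_axis inner_axis' inner_axis_axis power2_eq_square algebra_simps)

lemma continuous_on_newton_kernel:
  assumes "0 < \<epsilon>"
  shows "continuous_on UNIV (newton_kernel \<epsilon> :: real^'n::finite \<Rightarrow> real)"
proof -
  have "continuous_on UNIV (truncated_power (real CARD('n) / 2) (\<epsilon>\<^sup>2))"
    using assms by (intro continuous_at_imp_continuous_on ballI DERIV_isCont[OF truncated_power_has_derivative]) auto
  then show ?thesis
    unfolding newton_kernel_def by (rule continuous_on_compose2) (auto intro!: continuous_intros)
qed

lemma newton_kernel_bounds:
  fixes z :: "real^'n::finite"
  assumes "0 < \<epsilon>" "2 \<le> CARD('n)"
  shows "0 \<le> newton_kernel \<epsilon> z" "newton_kernel \<epsilon> z \<le> newton_kernel \<epsilon> (0::real^'n)"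
  unfolding newton_kernel_def using assms
  by (auto intro: truncated_power_nonneg truncated_power_antimono[of "\<epsilon>\<^sup>2" "real CARD('n) / 2" 0, simplified])

lemma newton_kernel_le_powr:
  fixes z :: "real^'n::finite"
  assumes "0 < \<epsilon>" "2 \<le> CARD('n)" "z \<noteq> 0"
  shows "newton_kernel \<epsilon> z \<le> norm z powr (2 - real CARD('n))"
proof -
  have "newton_kernel \<epsilon> z \<le> ((norm z)\<^sup>2) powr (1 - real CARD('n) / 2)"
    unfolding newton_kernel_def using assms by (intro truncated_power_le_powr) auto
  also have "\<dots> = norm z powr (2 * (1 - real CARD('n) / 2))"
    using assms powr_powr[of "norm z" 2 "1 - real CARD('n) / 2"] by simp
  finally show ?thesis
    by (simp add: algebra_simps)
qed

text \<open>A bound for the second difference quotients that is uniform in \<open>z\<close> and \<open>h\<close> serves as dominating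
  function when the limit \<open>h \<rightarrow> 0\<close> is taken under the integral.\<close>

lemma abs_diff2_newton_kernel_le:
  fixes z :: "real^'n::finite"
  assumes "0 < \<epsilon>" "2 \<le> CARD('n)" "\<bar>h\<bar> \<le> 1" "norm z \<le> D"
  defines "p \<equiv> real CARD('n) / 2"
  shows "\<bar>diff2 (h *\<^sub>R axis j 1) (newton_kernel \<epsilon>) z\<bar> \<le> 
    (2 * ((p - 1) * (\<epsilon>\<^sup>2) powr (-p)) + 2 * (((p - 1) * (p * (\<epsilon>\<^sup>2) powr (-p-1))) * (1 + 2 * D)\<^sup>2)) * h\<^sup>2"
proof -
  define a where "a = \<epsilon>\<^sup>2"
  define s where "s = (norm z)\<^sup>2"
  define C where "C = (p - 1) * (p * a powr (-p-1))"
  define d where "d = truncated_power_deriv p a s"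
  have p: "1 \<le> p" and a: "0 < a" and C: "0 \<le> C"
    using assms by (auto simp: a_def C_def)
  have bound: "\<bar>truncated_power p a (s + 2 * t * z $ j + t\<^sup>2) - truncated_power p a s - d * (2 * t * z $ j + t\<^sup>2)\<bar>
      \<le> C * ((1 + 2 * D)\<^sup>2 * h\<^sup>2)" if "\<bar>t\<bar> = \<bar>h\<bar>" for t
  proof -
    have "\<bar>2 * t * z $ j + t\<^sup>2\<bar> = \<bar>t\<bar> * \<bar>2 * z $ j + t\<bar>"
      by (simp add: power2_eq_square algebra_simps flip: abs_mult)
    also have "\<dots> \<le> \<bar>t\<bar> * (1 + 2 * D)"
      using component_le_norm_cart[of z j] assms that by (intro mult_left_mono) auto
    finally have "\<bar>2 * t * z $ j + t\<^sup>2\<bar>\<^sup>2 \<le> (\<bar>t\<bar> * (1 + 2 * D))\<^sup>2"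
      by (intro power_mono) auto
    then have "(2 * t * z $ j + t\<^sup>2)\<^sup>2 \<le> (1 + 2 * D)\<^sup>2 * h\<^sup>2"
      unfolding power2_abs that power_mult_distrib[of _ "1 + 2 * D"] by (simp only: power2_abs mult.commute)
    then have "C * (2 * t * z $ j + t\<^sup>2)\<^sup>2 \<le> C * ((1 + 2 * D)\<^sup>2 * h\<^sup>2)"
      using C by (rule mult_left_mono)
    moreover have "\<bar>truncated_power p a (s + 2 * t * z $ j + t\<^sup>2) - truncated_power p a s - d * (2 * t * z $ j + t\<^sup>2)\<bar>
      \<le> C * (2 * t * z $ j + t\<^sup>2)\<^sup>2"
      using truncated_power_taylor[OF a p, of "s + 2 * t * z $ j + t\<^sup>2" s]
      by (simp add: C_def d_def add.assoc)
    ultimately show ?thesis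
      by linarith
  qed
  have eq: "diff2 (h *\<^sub>R axis j 1) (newton_kernel \<epsilon>) z =
      truncated_power p a (s + 2 * h * z $ j + h\<^sup>2) + truncated_power p a (s + 2 * (-h) * z $ j + (-h)\<^sup>2) - 2 * truncated_power p a s"
    using norm_line[of z h j] norm_line[of z "-h" j]
    by (simp add: diff2_def newton_kernel_def p_def a_def s_def)
  have "\<bar>d\<bar> * h\<^sup>2 \<le> ((p - 1) * a powr (-p)) * h\<^sup>2"
    unfolding d_def by (intro mult_right_mono truncated_power_deriv_bounds a p) auto
  then have "\<bar>2 * (d * h\<^sup>2)\<bar> \<le> 2 * (((p - 1) * a powr (-p)) * h\<^sup>2)"
    by (simp add: abs_mult)
  moreover have "\<bar>diff2 (h *\<^sub>R axis j 1) (newton_kernel \<epsilon>) z - 2 * (d * h\<^sup>2)\<bar> \<le> 2 * (C * ((1 + 2 * D)\<^sup>2 * h\<^sup>2))"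
    using bound[of h] bound[of "-h"] unfolding eq 
    by (simp add: algebra_simps)
  ultimately have "\<bar>diff2 (h *\<^sub>R axis j 1) (newton_kernel \<epsilon>) z\<bar> \<le> 
      2 * (((p - 1) * a powr (-p)) * h\<^sup>2) + 2 * (C * ((1 + 2 * D)\<^sup>2 * h\<^sup>2))"
    by linarith
  then show ?thesis
    by (simp add: a_def C_def algebra_simps)
qed

lemma truncated_power_deriv_has_derivative:
  assumes "0 < a" "s \<noteq> a"
  shows "(truncated_power_deriv p a has_real_derivative (if s < a then 0 else (p - 1) * p * s powr (-p-1))) (at s)"
proof (cases "s < a")
  case True
  have "\<forall>\<^sub>F x in nhds s. x \<in> {..<a}"
    using True by (intro eventually_nhds_in_open) auto
  then have "\<forall>\<^sub>F x in nhds s. truncated_power_deriv p a x = (1 - p) * a powr (-p)"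
    by eventually_elim (simp add: truncated_power_deriv_def max_def)
  with True show ?thesis
    by (subst DERIV_cong_ev[OF refl _ refl]) auto
next
  case False
  then have "a < s"
    using assms by simp
  have "\<forall>\<^sub>F x in nhds s. x \<in> {a<..}"
    using \<open>a < s\<close> by (intro eventually_nhds_in_open) auto
  then have "\<forall>\<^sub>F x in nhds s. truncated_power_deriv p a x = (1 - p) * x powr (-p)"
    by eventually_elim (simp add: truncated_power_deriv_def max_def)
  moreover have "((\<lambda>x. (1 - p) * x powr (-p)) has_real_derivative (p - 1) * p * s powr (-p-1)) (at s)"
    using assms \<open>a < s\<close> by (auto intro!: derivative_eq_intros simp: algebra_simps)
  ultimately show ?thesis
    using False by (subst DERIV_cong_ev[OF refl _ refl]) auto
qed

text \<open>For a radial function \<open>\<phi> (\<bar>z\<bar>\<^sup>2)\<close> the Laplacian is \<open>4 s \<phi>'' s + 2 n \<phi>' s\<close> at \<open>s = \<bar>z\<bar>\<^sup>2\<close>. It vanishes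
  for the harmonic \<open>\<phi> s = s\<^sup>1\<^sup>-\<^sup>n\<^sup>/\<^sup>2\<close> outside the sphere and is constant for the linear piece inside.
  The value inside times the volume of the \<open>\<epsilon>\<close>-ball is independent of \<open>\<epsilon>\<close>.\<close>

lemma newton_kernel_discrete_laplacian_tendsto:
  fixes z :: "real^'n::finite"
  assumes "0 < \<epsilon>" "norm z \<noteq> \<epsilon>"
  defines "n \<equiv> real CARD('n)"
  shows "((\<lambda>h. discrete_laplacian h (newton_kernel \<epsilon>) z) \<longlongrightarrow>
    (if norm z < \<epsilon> then - n * (n - 2) / \<epsilon> ^ CARD('n) else 0)) (at 0)"
proof -
  define a where "a = \<epsilon>\<^sup>2"
  define s where "s = (norm z)\<^sup>2"
  define p where "p = n / 2"
  define D2 where "D2 = (if s < a then 0 else (p - 1) * p * s powr (-p-1))"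
  have a: "0 < a" and "s \<noteq> a" and less: "s < a \<longleftrightarrow> norm z < \<epsilon>"
    using assms norm_ge_zero[of z] 
    by (auto simp: a_def s_def power2_eq_iff intro: power_strict_mono power2_less_imp_less
        simp del: norm_ge_zero)
  have "((\<lambda>h. diff2 (h *\<^sub>R axis j 1) (newton_kernel \<epsilon>) z / h\<^sup>2) \<longlongrightarrow> 4 * D2 * (z $ j)\<^sup>2 + 2 * truncated_power_deriv p a s) (at 0)" for j
  proof -
    define q where "q t = s + 2 * t * z $ j + t\<^sup>2" for t :: real
    have q: "(q has_real_derivative 2 * z $ j + 2 * t) (at t)" for t
      unfolding q_def by (auto intro!: derivative_eq_intros)
    have "((\<lambda>h. diff2 h (\<lambda>t. truncated_power p a (q t)) 0 / h\<^sup>2) \<longlongrightarrow> 4 * D2 * (z $ j)\<^sup>2 + 2 * truncated_power_deriv p a s) (at 0)"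
    proof (rule diff2_quotient_tendsto)
      show "\<forall>\<^sub>F t in nhds 0. ((\<lambda>t. truncated_power p a (q t)) has_real_derivative truncated_power_deriv p a (q t) * (2 * z $ j + 2 * t)) (at t)"
        by (intro always_eventually allI DERIV_chain2[OF truncated_power_has_derivative[OF a] q])
      have "(truncated_power_deriv p a has_real_derivative D2) (at (q 0))"
        using truncated_power_deriv_has_derivative[OF a \<open>s \<noteq> a\<close>, of p] by (simp add: q_def D2_def)
      from DERIV_chain2[OF this q]
      have "((\<lambda>t. truncated_power_deriv p a (q t)) has_real_derivative D2 * (2 * z $ j)) (at 0)"
        by simp
      moreover have "((\<lambda>t. 2 * z $ j + 2 * t) has_real_derivative 2) (at 0)"
        by (auto intro!: derivative_eq_intros)
      ultimately
      show "((\<lambda>t. truncated_power_deriv p a (q t) * (2 * z $ j + 2 * t)) has_real_derivative 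
          4 * D2 * (z $ j)\<^sup>2 + 2 * truncated_power_deriv p a s) (at 0)"
        by (rule DERIV_cong[OF DERIV_mult]) (simp add: q_def power2_eq_square algebra_simps)
    qed
    moreover have "diff2 h (\<lambda>t. truncated_power p a (q t)) 0 = diff2 (h *\<^sub>R axis j 1) (newton_kernel \<epsilon>) z" for h
      using norm_line[of z h j] norm_line[of z "-h" j]
      by (simp add: diff2_def newton_kernel_def p_def a_def s_def q_def n_def)
    ultimately show ?thesis
      by simp
  qed
  then have "((\<lambda>h. discrete_laplacian h (newton_kernel \<epsilon>) z) \<longlongrightarrow> (\<Sum>j\<in>UNIV. 4 * D2 * (z $ j)\<^sup>2 + 2 * truncated_power_deriv p a s)) (at 0)"
    unfolding discrete_laplacian_def by (intro tendsto_sum)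
  also have "(\<Sum>j\<in>UNIV. 4 * D2 * (z $ j)\<^sup>2 + 2 * truncated_power_deriv p a s) = 4 * D2 * s + 2 * n * truncated_power_deriv p a s"
  proof -
    have "s = (\<Sum>j\<in>UNIV. (z $ j)\<^sup>2)"
      unfolding s_def power2_norm_eq_inner inner_vec_def by (simp add: power2_eq_square)
    then show ?thesis
      by (simp add: sum.distrib n_def flip: sum_distrib_left)
  qed
  also have "\<dots> = (if norm z < \<epsilon> then - n * (n - 2) / \<epsilon> ^ CARD('n) else 0)"
  proof (cases "s < a")
    case True
    have "a powr p = \<epsilon> ^ CARD('n)"
      using assms powr_powr[of \<epsilon> 2 p] by (simp add: a_def p_def n_def powr_realpow)
    then have "a powr (-p) = 1 / \<epsilon> ^ CARD('n)"
      by (simp add: powr_minus_divide)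
    with True assms(1) show ?thesis
      by (simp add: less[symmetric] D2_def truncated_power_deriv_def max_def p_def field_simps)
  next
    case False
    with a have "s powr (-p-1) * s = s powr (-p)"
      by (simp add: powr_diff)
    moreover have "4 * D2 * s = 4 * ((p - 1) * p) * (s powr (-p-1) * s)"
      using False by (simp add: D2_def)
    moreover have "truncated_power_deriv p a s = (1 - p) * s powr (-p)"
      using False by (simp add: truncated_power_deriv_def)
    ultimately show ?thesis
      using False by (simp add: less[symmetric] p_def) (simp add: field_simps)
  qed
  finally show ?thesis .
qed

section \<open>Rearrangement bound for the Newtonian potential\<close>

lemma unit_ball_measure_pos: "0 < measure lebesgue (ball (0::real^'n::finite) 1)"
  by (simp add: content_ball)

text \<open>Layer-cake formula: \<open>\<bar>z\<bar>\<^sup>2\<^sup>-\<^sup>n\<close> is the integral of \<open>(n - 2) r\<^sup>1\<^sup>-\<^sup>n\<close> over \<open>r \<ge> \<bar>z\<bar>\<close>, so by Fubini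
  the left side is the integral over \<open>r > 0\<close> of \<open>(n - 2) r\<^sup>1\<^sup>-\<^sup>n\<close> times the volume of the part of \<open>V\<close> in the
  \<open>r\<close>-ball. That volume is at most \<open>\<alpha> r\<^sup>n\<close> and at most \<open>\<alpha> R\<^sup>n\<close>. The first bound, used for
  \<open>r \<le> R\<close>, contributes \<open>(n - 2) \<alpha> R\<^sup>2 / 2\<close>; the second, used for \<open>r \<ge> R\<close>, contributes \<open>\<alpha> R\<^sup>2\<close>.\<close>

lemma nn_integral_newtonian_le:
  fixes V :: "(real^'n::finite) set" and x :: "real^'n"
  assumes V: "V \<in> sets borel" and n: "CARD('n) \<ge> 3"
    and R: "0 < R" "emeasure lborel V \<le> measure lebesgue (ball (0 :: real^'n) 1) * R ^ CARD('n)"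
  shows "(\<integral>\<^sup>+y. ennreal (norm (x - y) powr (2 - real CARD('n))) * indicator V y \<partial>lborel)
    \<le> real CARD('n) * measure lebesgue (ball (0 :: real^'n) 1) * R\<^sup>2 / 2"
proof -
  define n where "n = real CARD('n)"
  define \<alpha> where "\<alpha> = measure lebesgue (ball (0 :: real^'n) 1)"
  define w where "w = (\<lambda>r. (n - 2) * r powr (1 - n))"
  have n: "n \<ge> 3"
    using n by (simp add: n_def)
  have \<alpha>: "0 < \<alpha>"
    by (simp add: \<alpha>_def unit_ball_measure_pos)
  have [measurable]: "V \<in> sets borel" "w \<in> borel_measurable borel"
    using V by (auto simp: w_def)
  have tail: "(\<integral>\<^sup>+r. ennreal (w r) * indicator {d..} r \<partial>lborel) = ennreal (d powr (2 - n))" if "0 < d" for d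
  proof -
    have "(\<integral>\<^sup>+r. ennreal (w r) * indicator {d..} r \<partial>lborel) = ennreal (0 - - (d powr (2 - n)))"
    proof (rule nn_integral_FTC_atLeast[where F="\<lambda>r. - (r powr (2 - n))" and T=0])
      show "((\<lambda>r. - (r powr (2 - n))) has_real_derivative w r) (at r)" if "d \<le> r" for r
        using that \<open>0 < d\<close> by (auto intro!: derivative_eq_intros simp: w_def algebra_simps)
      show "0 \<le> w r" if "d \<le> r" for r
        using n by (simp add: w_def)
      have "((\<lambda>r. r powr (2 - n)) \<longlongrightarrow> 0) at_top"
        using n by (intro tendsto_neg_powr filterlim_ident) auto
      from tendsto_minus[OF this] show "((\<lambda>r. - (r powr (2 - n))) \<longlongrightarrow> 0) at_top"
        by simp
    qed measurable
    then show ?thesis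
      by simp
  qed
  have meas: "emeasure lborel (cball x r) = ennreal (\<alpha> * r ^ CARD('n))" if "0 \<le> r" for r
    using that by (simp add: emeasure_cball \<alpha>_def content_ball)
  have "(\<integral>\<^sup>+y. ennreal (norm (x - y) powr (2 - n)) * indicator V y \<partial>lborel) =
      (\<integral>\<^sup>+y. (\<integral>\<^sup>+r. ennreal (w r) * indicator {norm (x - y)..} r * indicator V y \<partial>lborel) \<partial>lborel)"
  proof (rule nn_integral_cong_AE)
    show "AE y in lborel. ennreal (norm (x - y) powr (2 - n)) * indicator V y =
      (\<integral>\<^sup>+r. ennreal (w r) * indicator {norm (x - y)..} r * indicator V y \<partial>lborel)"
      using AE_lborel_singleton[of x]
      by eventually_elim (simp add: nn_integral_multc tail)
  qed
  also have "\<dots> = (\<integral>\<^sup>+y. (\<integral>\<^sup>+r. ennreal (w r) * indicator (cball x r \<inter> V) y \<partial>lborel) \<partial>lborel)"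
    by (intro nn_integral_cong) (auto simp: indicator_def dist_norm)
  also have "\<dots> = (\<integral>\<^sup>+r. (\<integral>\<^sup>+y. ennreal (w r) * indicator (cball x r \<inter> V) y \<partial>lborel) \<partial>lborel)"
  proof (rule lborel_pair.Fubini'[symmetric])
    have "(\<lambda>(y, r). ennreal (w r) * (if dist x y \<le> r \<and> y \<in> V then 1 else 0)) \<in> borel_measurable (borel \<Otimes>\<^sub>M borel)"
      by measurable
    then show "(\<lambda>(y, r). ennreal (w r) * indicator (cball x r \<inter> V) y) \<in> borel_measurable (lborel \<Otimes>\<^sub>M lborel)"
      by (simp add: indicator_def mem_cball cong: if_cong) 
  qed
  also have "\<dots> = (\<integral>\<^sup>+r. ennreal (w r) * emeasure lborel (cball x r \<inter> V) \<partial>lborel)"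
    by (intro nn_integral_cong) (simp add: nn_integral_cmult_indicator)
  also have "\<dots> \<le> (\<integral>\<^sup>+r. ennreal ((n - 2) * \<alpha> * r) * indicator {0..R} r
      + ennreal (\<alpha> * R ^ CARD('n)) * (ennreal (w r) * indicator {R..} r) \<partial>lborel)"
  proof (rule nn_integral_mono)
    fix r :: real
    \<comment> \<open>For \<open>r < 0\<close> the ball is empty, and at \<open>r = 0\<close> the weight \<open>0 powr (1 - n)\<close> is \<open>0\<close>.\<close>
    consider "r < 0" | "r = 0" | "0 < r" "r \<le> R" | "R < r"
      by linarith
    then show "ennreal (w r) * emeasure lborel (cball x r \<inter> V) \<le> ennreal ((n - 2) * \<alpha> * r) * indicator {0..R} r
      + ennreal (\<alpha> * R ^ CARD('n)) * (ennreal (w r) * indicator {R..} r)"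
    proof cases
      case 3
      have "ennreal (w r) * emeasure lborel (cball x r \<inter> V) \<le> ennreal (w r) * ennreal (\<alpha> * r ^ CARD('n))"
        by (rule mult_left_mono[OF order_trans[OF emeasure_mono meas[THEN eq_refl]]]) (use 3 in auto)
      also have "\<dots> = ennreal ((n - 2) * \<alpha> * (r powr (1 - n) * r powr n))"
        using 3 n \<alpha> by (simp add: w_def n_def powr_realpow ac_simps flip: ennreal_mult')
      also have "r powr (1 - n) * r powr n = r"
        using 3 by (simp flip: powr_add)
      finally show ?thesis
        using 3 by (auto intro: add_increasing2)
    next
      case 4
      have "ennreal (w r) * emeasure lborel (cball x r \<inter> V) \<le> ennreal (w r) * ennreal (\<alpha> * R ^ CARD('n))"
        by (rule mult_left_mono[OF order_trans[OF emeasure_mono R(2)[folded \<alpha>_def]]]) auto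
      then show ?thesis
        using 4 R(1) by (simp add: mult.commute)
    qed (auto simp: w_def)
  qed
  also have "\<dots> = (\<integral>\<^sup>+r. ennreal ((n - 2) * \<alpha> * r) * indicator {0..R} r \<partial>lborel)
      + ennreal (\<alpha> * R ^ CARD('n)) * ennreal (R powr (2 - n))"
    using R(1) by (simp add: nn_integral_add nn_integral_cmult tail)
  also have "(\<integral>\<^sup>+r. ennreal ((n - 2) * \<alpha> * r) * indicator {0..R} r \<partial>lborel) 
      = ennreal ((n - 2) * \<alpha> * R\<^sup>2 / 2 - (n - 2) * \<alpha> * 0\<^sup>2 / 2)"
    by (rule nn_integral_FTC_Icc) (use R n \<alpha> in \<open>auto intro!: derivative_eq_intros\<close>)
  also have "\<alpha> * R ^ CARD('n) * R powr (2 - n) = \<alpha> * R\<^sup>2"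
  proof -
    have "R powr n * R powr (2 - n) = R powr 2"
      by (simp flip: powr_add)
    with R(1) show ?thesis
      by (simp add: n_def powr_realpow)
  qed
  then have "ennreal (\<alpha> * R ^ CARD('n)) * ennreal (R powr (2 - n)) = ennreal (\<alpha> * R\<^sup>2)"
    using \<alpha> R(1) by (simp flip: ennreal_mult)
  also have "ennreal ((n - 2) * \<alpha> * R\<^sup>2 / 2 - (n - 2) * \<alpha> * 0\<^sup>2 / 2) + ennreal (\<alpha> * R\<^sup>2) = ennreal (n * \<alpha> * R\<^sup>2 / 2)"
    using \<alpha> n R(1) by (simp add: field_simps flip: ennreal_plus)
  finally show ?thesis
    by (simp add: n_def \<alpha>_def)
qed

section \<open>Newtonian potentials of bounded sets\<close>

definition potential :: "(real^'n::finite) set \<Rightarrow> real \<Rightarrow> real^'n \<Rightarrow> real" where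
  "potential V \<epsilon> x = (LINT y|lborel. indicator V y * newton_kernel \<epsilon> (x - y))"

lemma newton_kernel_measurable [measurable]:
  assumes "0 < \<epsilon>"
  shows "(\<lambda>y. newton_kernel \<epsilon> (x - y :: real^'n::finite)) \<in> borel_measurable borel"
proof (rule borel_measurable_continuous_onI)
  show "continuous_on UNIV (\<lambda>y. newton_kernel \<epsilon> (x - y))"
    by (rule continuous_on_compose2[OF continuous_on_newton_kernel[OF assms]]) (auto intro!: continuous_intros)
qed

context
  fixes V :: "(real^'n::finite) set" and \<epsilon> :: real
  assumes V: "V \<in> sets borel" "bounded V" and eps: "0 < \<epsilon>" and n3: "CARD('n) \<ge> 3"
begin

lemma V_finite: "emeasure lborel V < \<infinity>"
  using V(2) emeasure_bounded_finite by auto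

lemma newton_kernel_bounds': 
  fixes z :: "real^'n"
  shows "0 \<le> newton_kernel \<epsilon> z" "newton_kernel \<epsilon> z \<le> newton_kernel \<epsilon> (0::real^'n)"
  using newton_kernel_bounds[OF eps, of z] n3 by auto

lemma newton_kernel_integrable: "integrable lborel (\<lambda>y. indicator V y * newton_kernel \<epsilon> (x - y))"
proof -
  have "integrable lborel (\<lambda>y. indicator V y *\<^sub>R newton_kernel \<epsilon> (x - y))"
    using V V_finite newton_kernel_bounds' newton_kernel_measurable[OF eps]
    by (intro integrableI_bounded_set_indicator[where B="newton_kernel \<epsilon> (0::real^'n)"]) auto
  then show ?thesis
    by simp
qed

lemma potential_nonneg: "0 \<le> potential V \<epsilon> x"
  unfolding potential_def using newton_kernel_bounds'
  by (intro integral_nonneg_AE) auto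

lemma continuous_on_potential: "continuous_on S (potential V \<epsilon>)"
proof (rule continuous_on_subset[OF _ subset_UNIV], rule continuous_at_imp_continuous_on, rule ballI)
  fix x
  show "isCont (potential V \<epsilon>) x"
    unfolding continuous_at_sequentially
  proof (intro allI impI)
    fix X assume X: "X \<longlonglongrightarrow> x"
    have "(\<lambda>i. LINT y|lborel. indicator V y * newton_kernel \<epsilon> (X i - y)) \<longlonglongrightarrow> (LINT y|lborel. indicator V y * newton_kernel \<epsilon> (x - y))"
    proof (rule integral_dominated_convergence)
      show "integrable lborel (\<lambda>y. indicator V y * newton_kernel \<epsilon> (0::real^'n))"
        using V(1) V_finite by simp
      show "AE y in lborel. (\<lambda>i. indicator V y * newton_kernel \<epsilon> (X i - y)) \<longlonglongrightarrow> indicator V y * newton_kernel \<epsilon> (x - y)"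
        by (intro AE_I2 tendsto_intros continuous_on_tendsto_compose[OF continuous_on_newton_kernel[OF eps]] X) auto
      show "AE y in lborel. norm (indicator V y * newton_kernel \<epsilon> (X i - y)) \<le> indicator V y * newton_kernel \<epsilon> (0::real^'n)" for i
        using newton_kernel_bounds' by (intro AE_I2) (auto split: split_indicator)
    qed (use V(1) eps in measurable)
    then show "(potential V \<epsilon> \<circ> X) \<longlonglongrightarrow> potential V \<epsilon> x"
      by (simp add: potential_def o_def)
  qed
qed

lemma integrable_diff2_newton_kernel: "integrable lborel (\<lambda>y. indicator V y * diff2 v (newton_kernel \<epsilon>) (x - y))"
  and integral_diff2_newton_kernel: "(LINT y|lborel. indicator V y * diff2 v (newton_kernel \<epsilon>) (x - y)) = diff2 v (potential V \<epsilon>) x"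
proof -
  have eq: "indicator V y * diff2 v (newton_kernel \<epsilon>) (x - y) = indicator V y * newton_kernel \<epsilon> (x + v - y)
    + indicator V y * newton_kernel \<epsilon> (x - v - y) - 2 * (indicator V y * newton_kernel \<epsilon> (x - y))" for y
    by (simp add: diff2_def algebra_simps)
  show "integrable lborel (\<lambda>y. indicator V y * diff2 v (newton_kernel \<epsilon>) (x - y))"
    unfolding eq by (simp add: newton_kernel_integrable)
  show "(LINT y|lborel. indicator V y * diff2 v (newton_kernel \<epsilon>) (x - y)) = diff2 v (potential V \<epsilon>) x"
    unfolding eq unfolding diff2_def potential_def by (simp add: newton_kernel_integrable)
qed

lemma discrete_laplacian_newton_kernel_eq:
  "indicator V y * discrete_laplacian h (newton_kernel \<epsilon>) (x - y)
    = (\<Sum>j\<in>UNIV. indicator V y * diff2 (h *\<^sub>R axis j 1) (newton_kernel \<epsilon>) (x - y) / h\<^sup>2)"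
  unfolding discrete_laplacian_def sum_distrib_left times_divide_eq_right ..

lemma integrable_discrete_laplacian_newton_kernel:
  "integrable lborel (\<lambda>y. indicator V y * discrete_laplacian h (newton_kernel \<epsilon>) (x - y))"
  unfolding discrete_laplacian_newton_kernel_eq
  by (intro Bochner_Integration.integrable_sum integrable_divide_zero integrable_diff2_newton_kernel)

lemma discrete_laplacian_potential:
  "discrete_laplacian h (potential V \<epsilon>) x
    = (LINT y|lborel. indicator V y * discrete_laplacian h (newton_kernel \<epsilon>) (x - y))"
  unfolding discrete_laplacian_newton_kernel_eq
  by (subst Bochner_Integration.integral_sum)
     (auto simp: discrete_laplacian_def integral_diff2_newton_kernel intro!: integrable_divide_zero integrable_diff2_newton_kernel)

text \<open>Dominated convergence: the integrand tends to \<open>-n (n - 2) / \<epsilon>\<^sup>n\<close> on the \<open>\<epsilon>\<close>-ball around \<open>x\<close> and to \<open>0\<close>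
  outside its closure, and the sphere between is a null set. Since \<open>V\<close> contains the whole ball, the integral of
  the limit is this constant times \<open>\<alpha> \<epsilon>\<^sup>n\<close>.\<close>

lemma discrete_laplacian_potential_tendsto:
  assumes ball: "ball x \<epsilon> \<subseteq> V"
  shows "(\<lambda>k. discrete_laplacian (inverse (real (Suc k))) (potential V \<epsilon>) x) \<longlonglongrightarrow>
    - (real CARD('n) * (real CARD('n) - 2) * measure lebesgue (ball (0 :: real^'n) 1))"
proof -
  define n where "n = real CARD('n)"
  define c where "c = - n * (n - 2) / \<epsilon> ^ CARD('n)"
  define h where "h = (\<lambda>k. inverse (real (Suc k)))"
  have h: "filterlim h (at 0) sequentially" "0 < h k" "h k \<le> 1" for k
    using LIMSEQ_inverse_real_of_nat
    by (auto simp: filterlim_at h_def field_simps)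
  obtain D where D: "\<And>y. y \<in> V \<Longrightarrow> norm (x - y) \<le> D"
    using V(2) bounded_any_center[of V x] by (auto simp: dist_norm)
  obtain B where B: "\<And>k z. norm z \<le> D \<Longrightarrow> \<bar>discrete_laplacian (h k) (newton_kernel \<epsilon>) (z::real^'n)\<bar> \<le> B"
  proof -
    define C where "C = 2 * ((n / 2 - 1) * (\<epsilon>\<^sup>2) powr (- (n / 2)))
      + 2 * (((n / 2 - 1) * (n / 2 * (\<epsilon>\<^sup>2) powr (- (n / 2) - 1))) * (1 + 2 * D)\<^sup>2)"
    have C: "\<bar>diff2 (h k *\<^sub>R axis j 1) (newton_kernel \<epsilon>) (z::real^'n)\<bar> \<le> C * (h k)\<^sup>2" if "norm z \<le> D" for k j z
      unfolding C_def n_def using n3 h(2,3)[of k] that by (intro abs_diff2_newton_kernel_le[OF eps]) auto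
    have "\<bar>discrete_laplacian (h k) (newton_kernel \<epsilon>) (z::real^'n)\<bar> \<le> n * C" if "norm z \<le> D" for k z
    proof -
      have "\<bar>diff2 (h k *\<^sub>R axis j 1) (newton_kernel \<epsilon>) z / (h k)\<^sup>2\<bar> \<le> C" for j
        using C[OF that] h(2)[of k] by (simp add: abs_div divide_le_eq)
      then have "\<bar>discrete_laplacian (h k) (newton_kernel \<epsilon>) z\<bar> \<le> (\<Sum>j\<in>(UNIV::'n set). C)"
        unfolding discrete_laplacian_def by (intro order_trans[OF sum_abs] sum_mono)
      then show ?thesis
        by (simp add: n_def)
    qed
    then show thesis
      by (rule that)
  qed
  have "(\<lambda>k. LINT y|lborel. indicator V y * discrete_laplacian (h k) (newton_kernel \<epsilon>) (x - y)) \<longlonglongrightarrow>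
      (LINT y|lborel. indicator (ball x \<epsilon>) y * c)"
  proof (rule integral_dominated_convergence)
    show "integrable lborel (\<lambda>y. indicator V y * B)"
      using V(1) V_finite by simp
    show "AE y in lborel. norm (indicator V y * discrete_laplacian (h k) (newton_kernel \<epsilon>) (x - y)) \<le> indicator V y * B" for k
      using B D by (intro AE_I2) (auto split: split_indicator)
    have "AE y in lborel. y \<notin> sphere x \<epsilon>"
      by (rule AE_not_in) (use negligible_sphere[of x \<epsilon>] in \<open>simp add: null_sets_completion_iff negligible_iff_null_sets\<close>)
    then show "AE y in lborel. (\<lambda>k. indicator V y * discrete_laplacian (h k) (newton_kernel \<epsilon>) (x - y)) \<longlonglongrightarrow>
        indicator (ball x \<epsilon>) y * c"
    proof eventually_elim
      case (elim y)
      then have "norm (x - y) \<noteq> \<epsilon>"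
        by (simp add: dist_norm)
      from filterlim_compose[OF newton_kernel_discrete_laplacian_tendsto[OF eps this] h(1)]
      have "(\<lambda>k. discrete_laplacian (h k) (newton_kernel \<epsilon>) (x - y)) \<longlonglongrightarrow> (if norm (x - y) < \<epsilon> then c else 0)"
        unfolding c_def n_def .
      from tendsto_mult_left[OF this, of "indicator V y"]
      show ?case
        using ball by (auto simp: dist_norm indicator_def subset_iff split: if_splits)
    qed
    show "(\<lambda>y. indicator V y * discrete_laplacian (h k) (newton_kernel \<epsilon>) (x - y)) \<in> borel_measurable lborel" for k
      using borel_measurable_integrable[OF integrable_discrete_laplacian_newton_kernel] .
    show "(\<lambda>y. indicator (ball x \<epsilon>) y * c) \<in> borel_measurable lborel"
      by (intro borel_measurable_times borel_measurable_indicator) auto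
  qed
  also have "(LINT y|lborel. indicator (ball x \<epsilon>) y * c) = measure lborel (ball x \<epsilon>) * c"
    by simp
  also have "\<dots> = - (n * (n - 2) * measure lebesgue (ball (0 :: real^'n) 1))"
    using eps by (simp add: content_ball c_def)
  finally show ?thesis
    by (simp add: discrete_laplacian_potential h_def n_def)
qed

lemma potential_le:
  assumes R: "0 < R" "emeasure lborel V \<le> measure lebesgue (ball (0 :: real^'n) 1) * R ^ CARD('n)"
  shows "potential V \<epsilon> x \<le> real CARD('n) * measure lebesgue (ball (0 :: real^'n) 1) * R\<^sup>2 / 2"
proof -
  have "ennreal (potential V \<epsilon> x) = (\<integral>\<^sup>+y. ennreal (indicator V y * newton_kernel \<epsilon> (x - y)) \<partial>lborel)"
    unfolding potential_def using newton_kernel_bounds'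
    by (intro nn_integral_eq_integral[symmetric] newton_kernel_integrable AE_I2) auto
  also have "\<dots> \<le> (\<integral>\<^sup>+y. ennreal (norm (x - y) powr (2 - real CARD('n))) * indicator V y \<partial>lborel)"
  proof (rule nn_integral_mono_AE)
    show "AE y in lborel. ennreal (indicator V y * newton_kernel \<epsilon> (x - y))
        \<le> ennreal (norm (x - y) powr (2 - real CARD('n))) * indicator V y"
      using AE_lborel_singleton[of x]
    proof eventually_elim
      case (elim y)
      then show ?case
        using newton_kernel_le_powr[OF eps, of "x - y"] n3 by (auto split: split_indicator intro: ennreal_leI)
    qed
  qed
  also have "\<dots> \<le> ennreal (real CARD('n) * measure lebesgue (ball (0 :: real^'n) 1) * R\<^sup>2 / 2)"
    by (rule nn_integral_newtonian_le[OF V(1) n3 R])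
  finally show ?thesis
    by (subst (asm) ennreal_le_iff) auto
qed

end

section \<open>The maximum principle\<close>

lemma filterlim_inverse_Suc: "filterlim (\<lambda>k. inverse (real (Suc k))) (at 0) sequentially"
  using LIMSEQ_inverse_real_of_nat by (auto simp: filterlim_at)

lemma discrete_laplacian_nonpos_at_local_max:
  fixes f :: "real^'n::finite \<Rightarrow> real"
  assumes "open S" "x \<in> S" "\<And>y. y \<in> S \<Longrightarrow> f y \<le> f x"
  shows "\<forall>\<^sub>F h in at 0. discrete_laplacian h f x \<le> 0"
proof -
  obtain r where r: "0 < r" "ball x r \<subseteq> S"
    using assms openE by blast
  have "\<forall>\<^sub>F h in at 0. \<bar>h\<bar> < r"
    using r(1) by (auto simp: eventually_at intro!: exI[of _ r])
  then show ?thesis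
  proof eventually_elim
    case (elim h)
    have "f (x + h *\<^sub>R axis j 1) \<le> f x" "f (x - h *\<^sub>R axis j 1) \<le> f x" for j
      using elim r(2) by (auto intro!: assms(3) subsetD[OF r(2)] simp: dist_norm)
    then have "diff2 (h *\<^sub>R axis j 1) f x / h\<^sup>2 \<le> 0" for j
      by (simp add: diff2_def divide_le_0_iff add_mono)
        (metis add_mono mult_2)
    then show ?case
      unfolding discrete_laplacian_def by (intro sum_nonpos)
  qed
qed

lemma limit_discrete_laplacian_nonpos_at_local_max:
  fixes f :: "real^'n::finite \<Rightarrow> real"
  assumes "open S" "x \<in> S" "\<And>y. y \<in> S \<Longrightarrow> f y \<le> f x"
    and "(\<lambda>k. discrete_laplacian (inverse (real (Suc k))) f x) \<longlonglongrightarrow> L"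
  shows "L \<le> 0"
  using assms(4)
proof (rule tendsto_upperbound)
  show "\<forall>\<^sub>F k in sequentially. discrete_laplacian (inverse (real (Suc k))) f x \<le> 0"
    by (rule eventually_compose_filterlim[OF discrete_laplacian_nonpos_at_local_max[of S x f] filterlim_inverse_Suc])
       (use assms(1-3) in auto)
qed simp

lemma discrete_laplacian_cmult: 
  "discrete_laplacian h (\<lambda>x. c * f x) x = c * discrete_laplacian h f x"
  by (simp add: discrete_laplacian_def diff2_def sum_distrib_left algebra_simps)

lemma discrete_laplacian_diff: 
  "discrete_laplacian h (\<lambda>x. f x - g x) x = discrete_laplacian h f x - discrete_laplacian h g x"
  unfolding discrete_laplacian_def sum_subtractf[symmetric] diff_divide_distrib[symmetric]
  by (simp add: diff2_def algebra_simps)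

section \<open>Comparison of an eigenfunction with a potential\<close>

text \<open>What the argument uses of \<open>\<bar>u\<bar>\<close> on a nodal domain. The equation \<open>-\<Delta> v = lam v\<close> is stated through
  difference quotients along a fixed sequence, the form in which it is compared with the potential.\<close>

locale eigenfunction_bump =
  fixes A :: "(real^'n::finite) set" and v :: "real^'n \<Rightarrow> real" and lam M :: real and x0
  assumes n3: "CARD('n) \<ge> 3"
    and A: "open A" "bounded A"
    and cont: "continuous_on (closure A) v"
    and frontier: "\<And>x. x \<in> frontier A \<Longrightarrow> v x = 0"
    and x0: "x0 \<in> A" "v x0 = M" "0 < M" 
    and le_M: "\<And>x. x \<in> A \<Longrightarrow> v x \<le> M"
    and eigen: "\<And>x. x \<in> A \<Longrightarrow> (\<lambda>k. discrete_laplacian (inverse (real (Suc k))) v x) \<longlonglongrightarrow> - lam * v x"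
begin

text \<open>At an interior maximum the Laplacian is nonpositive.\<close>

lemma lam_nonneg: "0 \<le> lam"
  using limit_discrete_laplacian_nonpos_at_local_max[OF A(1) x0(1) _ eigen[OF x0(1)]] le_M x0
  by (simp add: zero_le_mult_iff)

definition superlevel :: "real \<Rightarrow> (real^'n) set" where
  "superlevel \<delta> = {x \<in> A. \<delta> * M \<le> v x}"

text \<open>The superlevel set stays away from the frontier of \<open>A\<close>, where \<open>v = 0\<close>.\<close>

lemma compact_superlevel:
  assumes "0 < \<delta>"
  shows "compact (superlevel \<delta>)"
proof -
  have "superlevel \<delta> = closure A \<inter> v -` {\<delta> * M..}"
    using assms x0(3) frontier closure_subset[of A]
    by (auto simp: superlevel_def frontier_def interior_open[OF A(1)] not_le mult_pos_pos)
       (metis DiffI frontier frontier_def interior_open[OF A(1)] mult_pos_pos not_le)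
  moreover have "closed (closure A \<inter> v -` {\<delta> * M..})"
    by (intro continuous_closed_preimage cont) auto
  moreover have "bounded (superlevel \<delta>)"
    by (rule bounded_subset[OF A(2)]) (auto simp: superlevel_def)
  ultimately show ?thesis
    by (simp add: compact_eq_bounded_closed)
qed

text \<open>The function \<open>f = v - c \<Phi>\<close> attains its maximum over the compact set \<open>v \<ge> \<delta>' M\<close>. At a maximum point with
  \<open>v > \<delta>' M\<close> its Laplacian would be nonpositive, whereas the strict inequality on \<open>c\<close> makes it positive.
  So \<open>v \<le> \<delta>' M\<close> at the maximum point, and \<open>f \<le> \<delta>' M\<close> throughout the set because \<open>\<Phi> \<ge> 0\<close>.\<close>

lemma potential_comparison:
  assumes \<delta>: "0 < \<delta>" "\<delta> < \<delta>'" "\<delta>' < 1" 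
    and c: "0 < c" "lam * M < c * (real CARD('n) * (real CARD('n) - 2) * measure lebesgue (ball (0 :: real^'n) 1))"
  obtains \<epsilon> where "0 < \<epsilon>" "(1 - \<delta>') * M \<le> c * potential (superlevel \<delta>) \<epsilon> x0"
proof -
  define V where "V = superlevel \<delta>"
  define W where "W = superlevel \<delta>'"
  \<comment> \<open>An open set between \<open>W\<close> and \<open>V\<close>, which yields an \<open>\<epsilon>\<close> that works for all points of \<open>W\<close>.\<close>
  define U where "U = A \<inter> v -` {\<delta> * M<..}"
  have contA: "continuous_on A v"
    by (rule continuous_on_subset[OF cont closure_subset])
  have "open U"
    unfolding U_def by (intro continuous_open_preimage contA A) auto
  have W: "compact W"
    unfolding W_def using \<delta> by (intro compact_superlevel) auto
  have V: "compact V"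
    unfolding V_def using \<delta> by (intro compact_superlevel) auto
  have "\<delta> * M < \<delta>' * M"
    using \<delta> x0(3) by simp
  then have "W \<subseteq> U"
    by (auto simp: W_def U_def superlevel_def)
  obtain \<epsilon> where \<epsilon>: "0 < \<epsilon>" "(\<Union>x\<in>W. ball x \<epsilon>) \<subseteq> U"
    using compact_subset_open_imp_ball_epsilon_subset[OF W \<open>open U\<close> \<open>W \<subseteq> U\<close>] .
  have ball: "ball x \<epsilon> \<subseteq> V" if "x \<in> W" for x
    using \<epsilon>(2) that by (fastforce simp: V_def U_def superlevel_def)
  have Vb: "V \<in> sets borel" "bounded V"
    using V by (auto simp: borel_compact compact_imp_bounded)
  note pot = Vb \<epsilon>(1) n3
  define f where "f = (\<lambda>x. v x - c * potential V \<epsilon> x)"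
  have "x0 \<in> W"
    using x0 \<delta> by (simp add: W_def superlevel_def)
  have "continuous_on W v"
    by (rule continuous_on_subset[OF contA]) (auto simp: W_def superlevel_def)
  then have "continuous_on W f"
    unfolding f_def by (intro continuous_intros continuous_on_potential[OF pot])
  then obtain x1 where x1: "x1 \<in> W" "\<And>y. y \<in> W \<Longrightarrow> f y \<le> f x1"
    using continuous_attains_sup[OF W] \<open>x0 \<in> W\<close> by blast
  have "v x1 \<le> \<delta>' * M"
  proof (rule ccontr)
    assume "\<not> v x1 \<le> \<delta>' * M"
    define S where "S = A \<inter> v -` {\<delta>' * M<..}"
    have S: "open S" "x1 \<in> S" "S \<subseteq> W"
      using x1(1) \<open>\<not> v x1 \<le> \<delta>' * M\<close> 
      by (auto simp: S_def W_def superlevel_def intro!: continuous_open_preimage contA A)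
    have "x1 \<in> A"
      using S by (auto simp: S_def)
    have "(\<lambda>k. discrete_laplacian (inverse (real (Suc k))) f x1) \<longlonglongrightarrow> - lam * v x1 -
        c * - (real CARD('n) * (real CARD('n) - 2) * measure lebesgue (ball (0 :: real^'n) 1))"
      unfolding f_def discrete_laplacian_diff discrete_laplacian_cmult
      by (intro tendsto_intros eigen \<open>x1 \<in> A\<close> discrete_laplacian_potential_tendsto[OF pot ball] x1(1))
    from limit_discrete_laplacian_nonpos_at_local_max[OF S(1,2) _ this] x1(2) S(3)
    have "c * (real CARD('n) * (real CARD('n) - 2) * measure lebesgue (ball (0 :: real^'n) 1)) \<le> lam * v x1"
      by (auto simp: subset_iff)
    moreover have "lam * v x1 \<le> lam * M"
      using lam_nonneg le_M \<open>x1 \<in> A\<close> by (intro mult_left_mono) auto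
    ultimately show False
      using c(2) by linarith
  qed
  moreover have "f x0 \<le> f x1"
    using x1(2) \<open>x0 \<in> W\<close> .
  moreover have "0 \<le> c * potential V \<epsilon> x1"
    using c(1) potential_nonneg[OF pot] by simp
  ultimately have "(1 - \<delta>') * M \<le> c * potential V \<epsilon> x0"
    using x0(2) by (simp add: f_def algebra_simps)
  then show thesis
    using that \<epsilon>(1) by (simp add: V_def)
qed

text \<open>The comparison at \<open>x0\<close>, combined with the rearrangement bound, in the limits \<open>c \<rightarrow> c0\<close> and
  \<open>\<delta>' \<rightarrow> \<delta>\<close>.\<close>

lemma radius_bound:
  assumes \<delta>: "0 < \<delta>" "\<delta> < 1" 
    and R: "0 < R" "measure lborel (superlevel \<delta>) \<le> measure lebesgue (ball (0 :: real^'n) 1) * R ^ CARD('n)"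
  shows "1 - \<delta> \<le> lam * R\<^sup>2 / (2 * (real CARD('n) - 2))"
proof -
  define n where "n = real CARD('n)"
  define \<alpha> where "\<alpha> = measure lebesgue (ball (0 :: real^'n) 1)"
  have pos: "n \<ge> 3" "0 < \<alpha>"
    using n3 by (auto simp: n_def \<alpha>_def unit_ball_measure_pos)
  \<comment> \<open>The factor for which \<open>c0 \<Phi>\<close> has \<open>-\<Delta>\<close> exactly \<open>lam M\<close>; the comparison holds for every larger one.\<close>
  define c0 where "c0 = lam * M / (n * (n - 2) * \<alpha>)"
  have c0: "0 \<le> c0"
    using lam_nonneg x0(3) pos by (simp add: c0_def)
  define K where "K = n * \<alpha> * R\<^sup>2 / 2"
  have K: "0 < K"
    using pos R(1) by (simp add: K_def)
  have "emeasure lborel (superlevel \<delta>) < \<infinity>"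
    by (intro emeasure_bounded_finite compact_imp_bounded compact_superlevel \<delta>)
  then have emeas: "emeasure lborel (superlevel \<delta>) \<le> ennreal (\<alpha> * R ^ CARD('n))"
    using R(2) by (simp add: emeasure_eq_ennreal_measure \<alpha>_def ennreal_leI)
  have bound: "(1 - \<delta>') * M \<le> c * K" if less: "\<delta> < \<delta>'" "\<delta>' < 1" "c0 < c" for \<delta>' c
  proof -
    have "0 < c"
      using less(3) c0 by simp
    moreover have "lam * M < c * (n * (n - 2) * \<alpha>)"
      using less(3) pos by (simp add: c0_def divide_less_eq)
    ultimately obtain \<epsilon> where \<epsilon>: "0 < \<epsilon>" "(1 - \<delta>') * M \<le> c * potential (superlevel \<delta>) \<epsilon> x0"
      using potential_comparison[OF \<delta>(1) less(1,2), of c] by (auto simp: n_def \<alpha>_def)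
    have "potential (superlevel \<delta>) \<epsilon> x0 \<le> K"
      using potential_le[OF _ _ \<epsilon>(1) n3 R(1)] emeas compact_superlevel[OF \<delta>(1)]
      by (auto simp: K_def n_def \<alpha>_def borel_compact compact_imp_bounded)
    with \<open>0 < c\<close> \<epsilon>(2) show ?thesis
      by (meson mult_left_mono order_trans less_imp_le)
  qed
  have "(1 - \<delta>') * M / K \<le> c0" if "\<delta> < \<delta>'" "\<delta>' < 1" for \<delta>'
  proof (rule dense_ge)
    fix c assume "c0 < c"
    from bound[OF that this] show "(1 - \<delta>') * M / K \<le> c"
      using K by (simp add: divide_le_eq)
  qed
  then have "1 - c0 * K / M \<le> \<delta>'" if "\<delta> < \<delta>'" "\<delta>' < 1" for \<delta>'
  proof -
    have "(1 - \<delta>') * M \<le> c0 * K"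
      using \<open>\<And>\<delta>'. \<lbrakk>\<delta> < \<delta>'; \<delta>' < 1\<rbrakk> \<Longrightarrow> (1 - \<delta>') * M / K \<le> c0\<close>[OF that] K by (simp add: pos_divide_le_eq)
    then have "1 - \<delta>' \<le> c0 * K / M"
      using x0(3) by (simp add: pos_le_divide_eq)
    then show ?thesis
      by simp
  qed
  then have "1 - c0 * K / M \<le> \<delta>"
    by (rule dense_ge_bounded[OF \<delta>(2)])
  moreover have "c0 * K / M = lam * R\<^sup>2 / (2 * (n - 2))"
    using pos x0(3) by (simp add: c0_def K_def field_simps)
  ultimately show ?thesis
    by (simp add: n_def)
qed

text \<open>If the volume were smaller than that of the ball of radius \<open>sqrt Q\<close>, a slightly smaller radius \<open>R\<close> would
  still satisfy the hypothesis of \<open>radius_bound\<close>, whose conclusion is \<open>R\<^sup>2 \<ge> Q\<close>. Choosing \<open>R\<^sup>n\<close> strictly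
  between the two volumes (divided by \<open>\<alpha>\<close>) makes \<open>R\<close> positive.\<close>

lemma superlevel_volume:
  assumes \<delta>: "0 < \<delta>" "\<delta> < 1" 
  shows "(1 - \<delta>) powr (real CARD('n) / 2) * (2 * (real CARD('n) - 2)) powr (real CARD('n) / 2)
      * measure lebesgue (ball (0 :: real^'n) 1) * lam powr (- (real CARD('n) / 2))
    \<le> measure lborel (superlevel \<delta>)"
proof (cases "lam = 0")
  case False
  then have lam: "0 < lam"
    using lam_nonneg by simp
  define n where "n = real CARD('n)"
  define \<alpha> where "\<alpha> = measure lebesgue (ball (0 :: real^'n) 1)"
  have pos: "n \<ge> 3" "0 < \<alpha>"
    using n3 by (auto simp: n_def \<alpha>_def unit_ball_measure_pos)
  \<comment> \<open>The square of the critical radius.\<close>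
  define Q where "Q = (1 - \<delta>) * (2 * (n - 2)) / lam"
  have Q: "0 < Q"
    using \<delta> pos lam by (simp add: Q_def)
  have rhs: "(1 - \<delta>) powr (n / 2) * (2 * (n - 2)) powr (n / 2) * \<alpha> * lam powr (- (n / 2)) = \<alpha> * sqrt Q ^ CARD('n)"
  proof -
    have "sqrt Q ^ CARD('n) = Q powr (n / 2)"
      using Q by (simp add: n_def powr_half_sqrt[symmetric] powr_powr flip: powr_realpow)
    then show ?thesis
      using \<delta> pos lam by (simp add: Q_def powr_divide powr_mult powr_minus_divide)
  qed
  have "\<alpha> * sqrt Q ^ CARD('n) \<le> measure lborel (superlevel \<delta>)" 
  proof (rule ccontr)
    assume "\<not> ?thesis"
    then have less: "measure lborel (superlevel \<delta>) / \<alpha> < sqrt Q ^ CARD('n)"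
      using pos by (simp add: divide_less_eq mult.commute)
    then obtain t where t: "measure lborel (superlevel \<delta>) / \<alpha> < t" "t < sqrt Q ^ CARD('n)"
      using dense by blast
    have "0 < t"
      using t(1) pos by (meson divide_nonneg_pos le_less_trans measure_nonneg)
    define R where "R = root CARD('n) t"
    have R: "0 < R" "R ^ CARD('n) = t"
      using \<open>0 < t\<close> n3 by (auto simp: R_def)
    have "R < sqrt Q"
      using t(2) Q by (auto simp: R(2)[symmetric] intro: power_less_imp_less_base)
    then have "R\<^sup>2 < Q"
      using R(1) Q by (metis less_imp_le power_strict_mono pos2 real_sqrt_pow2)
    moreover have "1 - \<delta> \<le> lam * R\<^sup>2 / (2 * (n - 2))"
      using radius_bound[OF \<delta> R(1)] t(1) pos by (simp add: n_def R(2) divide_less_eq \<alpha>_def mult.commute)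
    then have "Q \<le> R\<^sup>2"
      using pos lam by (simp add: Q_def field_simps)
    ultimately show False
      by simp
  qed
  then show ?thesis
    unfolding rhs[symmetric] unfolding n_def \<alpha>_def .
qed simp

end

section \<open>Nodal domains\<close>

lemma nodal_domain_maximal:
  assumes "nodal_domain \<Omega> u A" "open B" "connected B" "B \<subseteq> {x \<in> \<Omega>. u x \<noteq> 0}" "A \<subseteq> B"
  shows "B = A"
  using assms unfolding nodal_domain_def by simp

text \<open>The empty set is open and connected, but any small ball in \<open>{u \<noteq> 0}\<close> properly contains it, so it is
  not maximal.\<close>

lemma nodal_domain_nonempty:
  assumes "nodal_domain \<Omega> u A" "open \<Omega>" "continuous_on \<Omega> u" "\<exists>x\<in>\<Omega>. u x \<noteq> 0"
  shows "A \<noteq> {}"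
proof
  assume "A = {}"
  have "open (\<Omega> \<inter> u -` (- {0}))"
    using assms by (intro continuous_open_preimage) auto
  then obtain x r where "0 < r" "ball x r \<subseteq> \<Omega> \<inter> u -` (- {0})"
    using assms(4) unfolding open_contains_ball by blast
  then have "ball x r \<subseteq> {x \<in> \<Omega>. u x \<noteq> 0}"
    by auto
  then have "ball x r = A"
    by (intro nodal_domain_maximal[OF assms(1)]) (auto simp: \<open>A = {}\<close>)
  then show False
    using \<open>0 < r\<close> \<open>A = {}\<close> by auto
qed

text \<open>If \<open>u x \<noteq> 0\<close> at a frontier point inside \<open>\<Omega>\<close>, a small ball around \<open>x\<close> could be adjoined to \<open>A\<close>,
  contradicting maximality.\<close>

lemma nodal_domain_frontier:
  assumes A: "nodal_domain \<Omega> u A" and \<Omega>: "open \<Omega>" "continuous_on \<Omega> u"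
    and u: "\<And>x. x \<in> frontier \<Omega> \<Longrightarrow> u x = 0" and x: "x \<in> frontier A"
  shows "u x = 0"
proof (cases "x \<in> \<Omega>")
  case False
  have "A \<subseteq> \<Omega>"
    using A by (auto simp: nodal_domain_def)
  then have "x \<in> frontier \<Omega>"
    using x False \<Omega>(1) closure_mono by (auto simp: frontier_def interior_open)
  then show ?thesis
    by (rule u)
next
  case True
  show ?thesis
  proof (rule ccontr)
    assume "u x \<noteq> 0"
    have "open (\<Omega> \<inter> u -` (- {0}))"
      using \<Omega> by (intro continuous_open_preimage) auto
    then obtain r where r: "0 < r" "ball x r \<subseteq> \<Omega> \<inter> u -` (- {0})"
      using True \<open>u x \<noteq> 0\<close> unfolding open_contains_ball by blast
    have "x \<in> closure A"
      using x by (simp add: frontier_def)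
    then have "A \<inter> ball x r \<noteq> {}"
      using r(1) by (metis closure_approachable disjoint_iff dist_commute mem_ball)
    then have "connected (A \<union> ball x r)"
      using A by (intro connected_Un) (auto simp: nodal_domain_def)
    moreover have "open (A \<union> ball x r)" "A \<union> ball x r \<subseteq> {x \<in> \<Omega>. u x \<noteq> 0}"
      using A r(2) by (auto simp: nodal_domain_def)
    ultimately have "A \<union> ball x r = A"
      using nodal_domain_maximal[OF A] by blast
    then have "x \<in> A"
      using centre_in_ball[of x r] r(1) by blast
    then show False
      using x A by (auto simp: frontier_def nodal_domain_def interior_open)
  qed
qed

lemma nodal_domain_sign:
  assumes "nodal_domain \<Omega> u A" "continuous_on \<Omega> u"
  obtains s :: real where "\<bar>s\<bar> = 1" "\<And>x. x \<in> A \<Longrightarrow> s * u x = \<bar>u x\<bar>"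
proof -
  have A: "connected A" "A \<subseteq> \<Omega>" "\<And>x. x \<in> A \<Longrightarrow> u x \<noteq> 0"
    using assms(1) by (auto simp: nodal_domain_def)
  then have "is_interval (u ` A)"
    using assms(2) by (intro connected_continuous_image[THEN is_interval_connected_1[THEN iffD2]])
      (auto elim: continuous_on_subset)
  then have "u y > 0" if "x \<in> A" "y \<in> A" "u x > 0" for x y
    using mem_is_interval_1_I[of "u ` A" "u y" "u x" 0] A(3) that by (auto simp: not_le[symmetric]) 
  then consider "\<forall>x\<in>A. u x > 0" | "\<forall>x\<in>A. u x < 0"
    using A(3) by (metis linorder_neqE_linordered_idom)
  then show thesis
    using that[of 1] that[of "-1"] by cases force+
qed

text \<open>Pointwise bounds control the essential supremum from above, so the threshold that defines \<open>high_set\<close> is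
  at most \<open>\<delta> M\<close>.\<close>

lemma superlevel_subset_high_set:
  assumes A: "open A" "bounded A" and u: "continuous_on A u" 
    and M: "\<And>x. x \<in> A \<Longrightarrow> \<bar>u x\<bar> \<le> M" "0 \<le> M" and "0 < \<delta>"
  shows "{x \<in> A. \<delta> * M \<le> \<bar>u x\<bar>} \<subseteq> high_set A u \<delta>" "high_set A u \<delta> \<in> lmeasurable"
proof -
  have [measurable]: "(\<lambda>x. \<bar>u x\<bar>) \<in> borel_measurable (lebesgue_on A)"
    using A by (intro continuous_imp_measurable_on_sets_lebesgue continuous_intros u) auto
  have "Linf_norm A u \<le> ennreal M"
    unfolding Linf_norm_def using M by (intro esssup_I AE_I2) (auto simp: ennreal_leI)
  then obtain L where L: "Linf_norm A u = ennreal L" "0 \<le> L" "L \<le> M"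
    using M(2) by (cases "Linf_norm A u") (auto simp: top_unique)
  then have eq: "high_set A u \<delta> = {x \<in> A. \<delta> * L \<le> \<bar>u x\<bar>}"
    using \<open>0 < \<delta>\<close> by (auto simp: high_set_def simp flip: ennreal_mult)
  have "\<delta> * L \<le> \<delta> * M"
    using L \<open>0 < \<delta>\<close> by simp
  then show "{x \<in> A. \<delta> * M \<le> \<bar>u x\<bar>} \<subseteq> high_set A u \<delta>"
    unfolding eq by auto
  have "open (A \<inter> (\<lambda>x. \<bar>u x\<bar>) -` {..<\<delta> * L})"
    using u A by (auto intro!: continuous_open_preimage continuous_intros)
  moreover have "high_set A u \<delta> = A - A \<inter> (\<lambda>x. \<bar>u x\<bar>) -` {..<\<delta> * L}"
    unfolding eq by auto
  ultimately have "high_set A u \<delta> \<in> sets borel"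
    using A(1) by simp
  then show "high_set A u \<delta> \<in> lmeasurable"
    using A(2) by (intro bounded_set_imp_lmeasurable) (auto simp: eq intro: bounded_subset sets_completionI_sets)
qed

theorem lemma1p2p2:
  fixes \<Omega> A :: "(real^'n::finite) set" and u :: "real^'n \<Rightarrow> real" and lam \<delta> :: real
  assumes "CARD('n) \<ge> 3"
    and "bounded_smooth_domain \<Omega>"
    and "dirichlet_eigenfunction \<Omega> lam u"
    and "nodal_domain \<Omega> u A"
    and "0 < \<delta>" and "\<delta> < 1"
  shows "measure lebesgue (high_set A u \<delta>) \<ge>
    (1 - \<delta>) powr (real CARD('n) / 2) * (2 * (real CARD('n) - 2)) powr (real CARD('n) / 2)
      * measure lebesgue (ball (0 :: real^'n) 1) * lam powr (- (real CARD('n) / 2))"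
proof -
  have \<Omega>: "open \<Omega>" "bounded \<Omega>"
    using assms(2) by (auto simp: bounded_smooth_domain_def)
  have u: "Ck_on 2 \<Omega> u" "continuous_on (closure \<Omega>) u" "\<exists>x\<in>\<Omega>. u x \<noteq> 0"
      "\<And>x. x \<in> \<Omega> \<Longrightarrow> laplacian u x = - lam * u x" "\<And>x. x \<in> frontier \<Omega> \<Longrightarrow> u x = 0"
    using assms(3) by (auto simp: dirichlet_eigenfunction_def)
  have A: "open A" "A \<subseteq> \<Omega>" "\<And>x. x \<in> A \<Longrightarrow> u x \<noteq> 0"
    using assms(4) by (auto simp: nodal_domain_def)
  have cont_u: "continuous_on \<Omega> u" "continuous_on (closure A) u"
    by (rule continuous_on_subset[OF u(2) closure_subset], rule continuous_on_subset[OF u(2) closure_mono[OF A(2)]])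
  have "bounded A"
    using \<Omega>(2) A(2) bounded_subset by blast
  have frontier: "u x = 0" if "x \<in> frontier A" for x
    using nodal_domain_frontier[OF assms(4) \<Omega>(1) cont_u(1) u(5) that] .
  have "A \<noteq> {}"
    using nodal_domain_nonempty[OF assms(4) \<Omega>(1) cont_u(1) u(3)] .
  obtain s where s: "\<bar>s\<bar> = 1" "\<And>x. x \<in> A \<Longrightarrow> s * u x = \<bar>u x\<bar>"
    using nodal_domain_sign[OF assms(4) cont_u(1)] by blast
  define v where "v = (\<lambda>x. s * u x)"
  have "compact (closure A)"
    using \<open>bounded A\<close> by simp
  moreover have "continuous_on (closure A) v"
    unfolding v_def by (intro continuous_intros cont_u(2))
  ultimately obtain x0 where x0: "x0 \<in> closure A" "\<And>y. y \<in> closure A \<Longrightarrow> v y \<le> v x0"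
    using continuous_attains_sup \<open>A \<noteq> {}\<close> by (metis closure_eq_empty)
  have v_pos: "0 < v x" if "x \<in> A" for x
    using s(2) A(3) that by (simp add: v_def)
  obtain y where "y \<in> A"
    using \<open>A \<noteq> {}\<close> by blast
  then have "0 < v x0"
    using v_pos x0(2) closure_subset by (meson less_le_trans subsetD)
  have "x0 \<in> A"
  proof (rule ccontr)
    assume "x0 \<notin> A"
    then have "x0 \<in> frontier A"
      using x0(1) A(1) by (simp add: frontier_def interior_open)
    from frontier[OF this] show False
      using \<open>0 < v x0\<close> by (simp add: v_def)
  qed
  interpret eigenfunction_bump A v lam "v x0" x0
  proof
    fix x assume x: "x \<in> A"
    show "v x \<le> v x0"
      using x x0(2) closure_subset by blast
    have "((\<lambda>h. discrete_laplacian h u x) \<longlongrightarrow> - lam * u x) (at 0)"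
      using discrete_laplacian_tendsto[OF \<Omega>(1) _ u(1), of x] u(4)[of x] x A(2) by auto
    from tendsto_mult_left[OF filterlim_compose[OF this filterlim_inverse_Suc], of s]
    show "(\<lambda>k. discrete_laplacian (inverse (real (Suc k))) v x) \<longlonglongrightarrow> - lam * v x"
      unfolding v_def discrete_laplacian_cmult by (simp add: mult.left_commute)
  qed (use assms(1) A(1) \<open>bounded A\<close> \<open>continuous_on (closure A) v\<close> frontier \<open>x0 \<in> A\<close> \<open>0 < v x0\<close> in \<open>auto simp: v_def\<close>)
  have M: "\<bar>u x\<bar> \<le> v x0" if "x \<in> A" for x
    using le_M[OF that] s(2)[OF that] by (simp add: v_def)
  have "v x = \<bar>u x\<bar>" if "x \<in> A" for x
    using s(2)[OF that] by (simp add: v_def)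
  then have "superlevel \<delta> = {x \<in> A. \<delta> * v x0 \<le> \<bar>u x\<bar>}"
    by (auto simp: superlevel_def)
  moreover have "continuous_on A u"
    by (rule continuous_on_subset[OF cont_u(2) closure_subset])
  ultimately have sub: "superlevel \<delta> \<subseteq> high_set A u \<delta>" "high_set A u \<delta> \<in> lmeasurable"
    using superlevel_subset_high_set[of A u "v x0" \<delta>] A(1) \<open>bounded A\<close> M \<open>0 < v x0\<close> assms(5) by auto
  have "superlevel \<delta> \<in> sets borel"
    using compact_superlevel[OF assms(5)] by (rule borel_compact)
  then have "measure lborel (superlevel \<delta>) = measure lebesgue (superlevel \<delta>)"
    by simp
  also have "\<dots> \<le> measure lebesgue (high_set A u \<delta>)"
    using sub \<open>superlevel \<delta> \<in> sets borel\<close> by (intro measure_mono_fmeasurable) auto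
  finally show ?thesis
    using superlevel_volume[OF assms(5,6)] by simp
qed

end
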